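(* Let $I=\{1,\dots,n\}$, let $A$ be a finite set, and let $G$ be a strategic game with player set $I$, common action set $A$ and payoff functions $\pi_i:A^I\to\mathbb{R}$ ($i\in I$). The following two definitions of "$G$ is symmetric" are equivalent: (1) for all $i,j\in I$ and all $\mathbf{a},\mathbf{b}\in A^I$, if $a_i=b_j$ and $\#\mathbf{a}_{-i}=\#\mathbf{b}_{-j}$, then $\pi_i(\mathbf{a})=\pi_j(\mathbf{b})$; (2) $G$ is invariant under all permutations of $I$, i.e. for every permutation $\sigma$ of $I$, every $\mathbf{a}\in A^I$ and every $i\in I$, $\pi_{\sigma(i)}(a_1,\dots,a_n)=\pi_i(a_{\sigma(1)},\dots,a_{\sigma(n)})$.
   Context: A profile is an element $\mathbf{a}=(a_1,\dots,a_n)\in A^I$; $\mathbf{a}_{-i}$ is the vector obtained by deleting the $i$-th coordinate. For a vector $\mathbf{x}$ with entries in $A$, $\#\mathbf{x}=(\#(a,\mathbf{x}))_{a\in A}$, where $\#(a,\mathbf{x})$ is the number of coordinates of $\mathbf{x}$ equal to $a$. *)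

theory Defs
  imports Complex_Main "HOL-Library.FuncSet" "HOL-Combinatorics.Permutations"
begin

text \<open>A vector with entries in \<open>A\<close> and coordinates indexed by a finite set \<open>J\<close> is an
  element of \<open>J \<rightarrow>\<^sub>E A\<close>; the functions below that read off its entries take \<open>J\<close> as an argument.\<close>

definition profiles :: "'i set \<Rightarrow> 'a set \<Rightarrow> ('i \<Rightarrow> 'a) set" where
  "profiles I A = I \<rightarrow>\<^sub>E A"

definition delete_coord :: "'i set \<Rightarrow> 'i \<Rightarrow> ('i \<Rightarrow> 'a) \<Rightarrow> ('i \<Rightarrow> 'a)" where
  "delete_coord I i a = restrict a (I - {i})"

definition occurrences :: "'i set \<Rightarrow> 'a \<Rightarrow> ('i \<Rightarrow> 'a) \<Rightarrow> nat" where
  "occurrences J c x = card {k \<in> J. x k = c}"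

definition tally :: "'a set \<Rightarrow> 'i set \<Rightarrow> ('i \<Rightarrow> 'a) \<Rightarrow> ('a \<Rightarrow> nat)" where
  "tally A J x = (\<lambda>c\<in>A. occurrences J c x)"

text \<open>A game is given by its player set \<open>I\<close>, its common action set \<open>A\<close> and its payoff functions
  \<open>\<pi>\<close>; only the values \<open>\<pi> i a\<close> with \<open>i \<in> I\<close> and \<open>a \<in> profiles I A\<close> are relevant.\<close>

definition count_symmetric ::
  "'i set \<Rightarrow> 'a set \<Rightarrow> ('i \<Rightarrow> ('i \<Rightarrow> 'a) \<Rightarrow> real) \<Rightarrow> bool" where
  "count_symmetric I A \<pi> \<longleftrightarrow>
     (\<forall>i\<in>I. \<forall>j\<in>I. \<forall>a\<in>profiles I A. \<forall>b\<in>profiles I A.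
        a i = b j \<and>
        tally A (I - {i}) (delete_coord I i a) = tally A (I - {j}) (delete_coord I j b)
        \<longrightarrow> \<pi> i a = \<pi> j b)"

definition permutation_invariant ::
  "'i set \<Rightarrow> 'a set \<Rightarrow> ('i \<Rightarrow> ('i \<Rightarrow> 'a) \<Rightarrow> real) \<Rightarrow> bool" where
  "permutation_invariant I A \<pi> \<longleftrightarrow>
     (\<forall>\<sigma>. \<sigma> permutes I \<longrightarrow>
        (\<forall>a\<in>profiles I A. \<forall>i\<in>I. \<pi> (\<sigma> i) a = \<pi> i (\<lambda>k\<in>I. a (\<sigma> k))))"

end

theory Submission
  imports Defs
begin

text \<open>
  Both notions say that a payoff depends only on a player's own action and on the multiset of the
  opponents' actions. Relabelling a profile by a permutation \<open>\<sigma>\<close> carries the opponents of \<open>i\<close>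
  bijectively to the opponents of \<open>\<sigma> i\<close>, so it preserves both data; this is
  \<open>tally_delete_coord_permute\<close> and shows that count symmetry implies permutation invariance.
  Conversely, two profiles that agree in these data, seen from \<open>i\<close> and from \<open>j\<close>, differ only by a
  relabelling: by \<open>ex_bij_betw_matching_fibres\<close> the equal tallies give a bijection between
  the opponents that matches actions, and sending \<open>j\<close> to \<open>i\<close> extends it to a permutation of
  the players.
\<close>

text \<open>Fibres of equal size admit bijections, one for each value, and these glue together because the
  fibres partition the two domains.\<close>

lemma ex_bij_betw_matching_fibres:
  assumes "finite J" "finite K"
    and card_eq: "\<And>c. card {k \<in> J. f k = c} = card {k \<in> K. g k = c}"
  shows "\<exists>h. bij_betw h J K \<and> (\<forall>k\<in>J. g (h k) = f k)"
proof -
  have "\<exists>H. bij_betw H {k \<in> J. f k = c} {k \<in> K. g k = c}" for c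
    using assms by (intro finite_same_card_bij) auto
  then obtain H where H: "\<And>c. bij_betw (H c) {k \<in> J. f k = c} {k \<in> K. g k = c}"
    by metis
  define h where "h k = H (f k) k" for k
  have h: "h k \<in> K \<and> g (h k) = f k" if "k \<in> J" for k
    using bij_betwE[OF H[of "f k"]] that by (auto simp: h_def)
  have "inj_on h J"
  proof (rule inj_onI)
    fix k l assume kl: "k \<in> J" "l \<in> J" "h k = h l"
    then have "f k = f l" using h by metis
    then show "k = l"
      using kl inj_onD[OF bij_betw_imp_inj_on[OF H[of "f k"]], of k l] by (simp add: h_def)
  qed
  moreover have "m \<in> h ` J" if "m \<in> K" for m
  proof -
    have "m \<in> H (g m) ` {k \<in> J. f k = g m}"
      using bij_betw_imp_surj_on[OF H[of "g m"]] that by auto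
    then obtain k where "k \<in> J" "f k = g m" "m = H (g m) k" by blast
    then have "m = h k" by (simp add: h_def)
    with \<open>k \<in> J\<close> show ?thesis by blast
  qed
  ultimately show ?thesis using h unfolding bij_betw_def by blast
qed

lemma tally_delete_coord:
  "tally A (I - {i}) (delete_coord I i a) = (\<lambda>c\<in>A. card {k \<in> I - {i}. a k = c})"
proof -
  have "{k \<in> I - {i}. delete_coord I i a k = c} = {k \<in> I - {i}. a k = c}" for c
    by (auto simp: delete_coord_def)
  then show ?thesis by (simp add: tally_def occurrences_def)
qed

lemma tally_delete_coord_permute:
  assumes "\<sigma> permutes I"
  shows "tally A (I - {i}) (delete_coord I i (\<lambda>k\<in>I. a (\<sigma> k)))
       = tally A (I - {\<sigma> i}) (delete_coord I (\<sigma> i) a)"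
proof -
  have "card {k \<in> I - {i}. (\<lambda>k\<in>I. a (\<sigma> k)) k = c} = card {k \<in> I - {\<sigma> i}. a k = c}" for c
  proof -
    have "\<sigma> ` {k \<in> I - {i}. (\<lambda>k\<in>I. a (\<sigma> k)) k = c} = {k \<in> I - {\<sigma> i}. a k = c}"
    proof (intro equalityI subsetI)
      fix m assume m: "m \<in> {k \<in> I - {\<sigma> i}. a k = c}"
      then obtain k where "k \<in> I" "m = \<sigma> k"
        using permutes_image[OF assms] by blast
      with m show "m \<in> \<sigma> ` {k \<in> I - {i}. (\<lambda>k\<in>I. a (\<sigma> k)) k = c}" by auto
    qed (auto simp: permutes_in_image[OF assms] inj_eq[OF permutes_inj[OF assms]])
    then show ?thesis
      using card_image[OF permutes_inj_on[OF assms]] by metis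
  qed
  then show ?thesis unfolding tally_delete_coord by presburger
qed

text \<open>A tally records only the values in \<open>A\<close>; the fibres over all other values are empty because
  profiles take values in \<open>A\<close>.\<close>

lemma ex_permutation_if_tally_eq:
  assumes "finite I" "i \<in> I" "j \<in> I" "a \<in> profiles I A" "b \<in> profiles I A" "a i = b j"
    and tally_eq: "tally A (I - {i}) (delete_coord I i a) = tally A (I - {j}) (delete_coord I j b)"
  obtains \<sigma> where "\<sigma> permutes I" "\<sigma> j = i" "b = (\<lambda>k\<in>I. a (\<sigma> k))"
proof -
  have "card {k \<in> I - {j}. b k = c} = card {k \<in> I - {i}. a k = c}" for c
  proof (cases "c \<in> A")
    case True
    with fun_cong[OF tally_eq, of c] show ?thesis
      by (simp add: tally_delete_coord)
  next
    case False
    then have "{k \<in> I - {j}. b k = c} = {}" "{k \<in> I - {i}. a k = c} = {}"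
      using assms(4,5) by (auto simp: profiles_def)
    then show ?thesis by presburger
  qed
  with ex_bij_betw_matching_fibres[of "I - {j}" "I - {i}" b a] \<open>finite I\<close>
  obtain h where h: "bij_betw h (I - {j}) (I - {i})" "\<And>k. k \<in> I - {j} \<Longrightarrow> a (h k) = b k"
    by auto
  define \<sigma> where "\<sigma> k = (if k = j then i else if k \<in> I then h k else k)" for k
  have "bij_betw \<sigma> (I - {j}) (I - {i})"
    using h(1) by (rule bij_betw_cong[THEN iffD1, rotated]) (auto simp: \<sigma>_def)
  then have "bij_betw \<sigma> ((I - {j}) \<union> {j}) ((I - {i}) \<union> {i})"
    by (rule bij_betw_combine) (auto simp: \<sigma>_def)
  then have "bij_betw \<sigma> I I"
    using assms(2,3) by (simp add: insert_absorb)
  then have "\<sigma> permutes I"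
    by (rule bij_imp_permutes) (use assms(3) in \<open>auto simp: \<sigma>_def\<close>)
  moreover have "\<sigma> j = i" by (simp add: \<sigma>_def)
  moreover have "b = (\<lambda>k\<in>I. a (\<sigma> k))"
  proof
    fix k show "b k = (\<lambda>k\<in>I. a (\<sigma> k)) k"
      using assms(5,6) h(2)[of k] by (auto simp: \<sigma>_def profiles_def)
  qed
  ultimately show thesis by (rule that)
qed

lemma count_symmetric_iff_permutation_invariant:
  assumes "finite I"
  shows "count_symmetric I A \<pi> \<longleftrightarrow> permutation_invariant I A \<pi>"
proof
  assume sym: "count_symmetric I A \<pi>"
  show "permutation_invariant I A \<pi>"
    unfolding permutation_invariant_def
  proof (intro allI impI ballI)
    fix \<sigma> a i assume \<sigma>: "\<sigma> permutes I" and a: "a \<in> profiles I A" and i: "i \<in> I"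
    have \<sigma>i: "\<sigma> i \<in> I" using \<sigma> i by (simp add: permutes_in_image)
    have b: "(\<lambda>k\<in>I. a (\<sigma> k)) \<in> profiles I A"
      using a permutes_in_image[OF \<sigma>] by (auto simp: profiles_def)
    have "a (\<sigma> i) = (\<lambda>k\<in>I. a (\<sigma> k)) i" using i by simp
    with sym \<sigma>i i a b tally_delete_coord_permute[OF \<sigma>, of A i a, symmetric]
    show "\<pi> (\<sigma> i) a = \<pi> i (\<lambda>k\<in>I. a (\<sigma> k))"
      unfolding count_symmetric_def by blast
  qed
next
  assume inv: "permutation_invariant I A \<pi>"
  show "count_symmetric I A \<pi>"
    unfolding count_symmetric_def
  proof (intro ballI impI, elim conjE)
    fix i j a b
    assume ij: "i \<in> I" "j \<in> I" and ab: "a \<in> profiles I A" "b \<in> profiles I A" "a i = b j"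
      and "tally A (I - {i}) (delete_coord I i a) = tally A (I - {j}) (delete_coord I j b)"
    then obtain \<sigma> where "\<sigma> permutes I" "\<sigma> j = i" "b = (\<lambda>k\<in>I. a (\<sigma> k))"
      using ex_permutation_if_tally_eq[OF assms] by metis
    with inv ij ab show "\<pi> i a = \<pi> j b"
      unfolding permutation_invariant_def by metis
  qed
qed

theorem theorem3p7:
  fixes n :: nat and A :: "'a set" and \<pi> :: "nat \<Rightarrow> (nat \<Rightarrow> 'a) \<Rightarrow> real"
  assumes "finite A"
  shows "count_symmetric {1..n} A \<pi> \<longleftrightarrow> permutation_invariant {1..n} A \<pi>"
  by (rule count_symmetric_iff_permutation_invariant) simp

end
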